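(* Let $q\ge3$ be odd and let $a$ be a real number with $a>\frac{1}{B_q}$. Then for any boundary condition $\frac{u(1)}{u(0)}=\tan\theta$ and any $E\in S_q$, there exist potentials $V:\mathbb{N}\to\mathbb{R}$ such that $\limsup_{n\to\infty}|nV(n)|=a$ and the associated Schrödinger operator $H=H_0+V$ (with this boundary condition) has eigenvalue $E$.
   Context: Here $\mathbb{N}=\{1,2,\dots\}$. The half-line discrete Schrödinger operator $H=H_0+V$ with boundary condition $\theta\in[0,\pi]$ is given by $(Hu)(n)=u(n+1)+u(n-1)+V(n)u(n)$ for $n\ge 1$, with $\frac{u(1)}{u(0)}=\tan\theta$ (i.e. $u(1)\cos\theta=u(0)\sin\theta$). A number $E$ is an eigenvalue if there is a nontrivial solution $u$ of $u(n+1)+u(n-1)+V(n)u(n)=Eu(n)$ ($n\ge1$) satisfying the boundary condition with $u\in\ell^2(\mathbb{N})$. For $E\in(-2,2)$, $k(E)\in(0,1)$ is defined by $E=2\cos\pi k(E)$. For an integer $q\ge2$, $S_q=\{E\in(-2,2): k(E)=p/q \text{ for some } p\in\{1,\dots,q-1\} \text{ with } \gcd(p,q)=1\}$. For odd $q\ge3$, $B_q=\frac{1+\cos(\pi/q)}{q\sin(\pi/q)}$. *)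

theory Defs
  imports "HOL-Analysis.Analysis"
begin

text \<open>
  The positive integers are the sites of the half-line. A potential is a function on
  \<^typ>\<open>nat\<close> whose value at 0 is never used; a function \<open>u\<close> carries the additional
  value \<open>u 0\<close>, which enters only through the boundary condition and the equation at \<open>n = 1\<close>.
\<close>

definition schroedinger :: "(nat \<Rightarrow> real) \<Rightarrow> (nat \<Rightarrow> real) \<Rightarrow> nat \<Rightarrow> real" where
  "schroedinger V u n = u (n + 1) + u (n - 1) + V n * u n"

text \<open>
  \<open>u 1 / u 0 = tan \<theta>\<close> in a form that is also meaningful when \<open>u 0 = 0\<close> (\<open>\<theta> = \<pi>/2\<close>).
\<close>

definition boundary_condition :: "real \<Rightarrow> (nat \<Rightarrow> real) \<Rightarrow> bool" where
  "boundary_condition \<theta> u \<longleftrightarrow> u 1 * cos \<theta> = u 0 * sin \<theta>"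

text \<open>
  Since \<open>V\<close> and \<open>E\<close> are real, real and imaginary parts of a complex eigenfunction
  are again solutions, so it suffices to consider real \<open>u\<close>.
\<close>

definition is_eigenvalue :: "(nat \<Rightarrow> real) \<Rightarrow> real \<Rightarrow> real \<Rightarrow> bool" where
  "is_eigenvalue V \<theta> E \<longleftrightarrow>
     (\<exists>u. (\<exists>n. u n \<noteq> 0) \<and>
          (\<forall>n\<ge>1. schroedinger V u n = E * u n) \<and>
          boundary_condition \<theta> u \<and>
          summable (\<lambda>n. (u (Suc n))\<^sup>2))"

definition quasimomentum :: "real \<Rightarrow> real" where
  "quasimomentum E = (THE k. k \<in> {0<..<1} \<and> E = 2 * cos (pi * k))"

lemma quasimomentum_unique:
  assumes "E \<in> {-2<..<2}"
  shows "\<exists>!k. k \<in> {0<..<1} \<and> E = 2 * cos (pi * k)"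
proof (rule ex1I)
  have "0 < arccos (E / 2)" "arccos (E / 2) < pi"
    using assms arccos_lt_bounded [of "E / 2"] by auto
  then show "arccos (E / 2) / pi \<in> {0<..<1} \<and> E = 2 * cos (pi * (arccos (E / 2) / pi))"
    using assms by (simp add: cos_arccos)
next
  fix k assume k: "k \<in> {0<..<1} \<and> E = 2 * cos (pi * k)"
  then have "arccos (E / 2) = pi * k"
    by (simp add: arccos_cos mult_le_cancel_left1)
  then show "k = arccos (E / 2) / pi" by simp
qed

definition S :: "nat \<Rightarrow> real set" where
  "S q = {E \<in> {-2<..<2}.
            \<exists>p\<in>{1..q - 1}. gcd p q = 1 \<and> quasimomentum E = real p / real q}"

definition B :: "nat \<Rightarrow> real" where
  "B q = (1 + cos (pi / real q)) / (real q * sin (pi / real q))"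

end

theory Submission
  imports Defs
begin

text \<open>
  Write \<open>E = 2 * cos \<kappa>\<close> with \<open>\<kappa> = \<pi> * p / q\<close>, and attach to a solution \<open>u\<close> the complex number
  \<open>z n = e\<^sup>i\<^sup>\<kappa> * u (n + 1) - u n\<close>. For \<open>V = 0\<close> one step of the recursion multiplies \<open>z\<close> by
  \<open>e\<^sup>i\<^sup>\<kappa>\<close>; a potential first shifts \<open>z\<close> by the real number \<open>- V * u\<close>, where
  \<open>u (n + 1) = Im (z n) / sin \<kappa>\<close>. So, to first order, \<open>V\<close> changes \<open>|z n|\<^sup>2\<close> by
  \<open>- V * Im ((z n)\<^sup>2) / sin \<kappa>\<close>. The site \<open>n + 1\<close> therefore receives \<open>V = \<plusminus> a / (n + 1)\<close>,
  with the sign, read off from \<open>u (n + 1)\<close> and \<open>u n\<close>, that makes \<open>|z|\<close> decrease. Since \<open>|n * V n| = a\<close>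
  at every site, the limit superior is \<open>a\<close>, and the boundary condition only fixes the initial
  values. What has to be shown is that \<open>u\<close> is square summable.

  Over \<open>q\<close> consecutive sites, \<open>z\<close> differs from a pure rotation by \<open>O(1/n)\<close>, and its square runs
  through the rotations of one complex number by all \<open>q\<close>-th roots of unity, because \<open>q\<close> is odd and
  coprime to \<open>p\<close>. The sum of \<open>|Im|\<close> over such a set of points depends on their common phase, but it is at
  least \<open>q * B q\<close> times their modulus (\<open>sum_abs_Im_square_rational_rotation_ge\<close>): \<open>q * B q\<close> is
  \<open>cot (\<pi> / (2 * q))\<close>, the value in the worst phase. A slow drift of the phase hence does no harm,
  and with \<open>r n = |z n|\<^sup>2\<close> and \<open>b = a / sin \<kappa> \<ge> a\<close>
  \<open>r (n + q) \<le> (1 - b * q * B q / (n + q) + O(1/n\<^sup>2)) * r n\<close>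
  (\<open>damped_rotation_block_decay\<close>). Since \<open>b * B q > 1\<close>, this is decay faster than \<open>1/n\<close>, and a
  telescoping argument of Kummer type (\<open>summable_of_lagged_decay\<close>) gives \<open>\<Sum>n. r n < \<infinity>\<close>.
\<close>

section \<open>The mean of the absolute sine over a rational rotation\<close>

text \<open>Multiplication by \<open>c\<close> permutes the residues modulo \<open>q\<close>.\<close>

lemma sum_periodic_mult_coprime:
  fixes h :: "nat \<Rightarrow> real"
  assumes per: "\<And>j. h (j + q) = h j" and "q > 0" and cop: "coprime c q"
  shows "(\<Sum>j<q. h (c * j)) = (\<Sum>j<q. h j)"
proof -
  have mult: "h (j + i * q) = h j" for i j
    by (induction i) (use per[of "j + _ * q"] in \<open>simp_all add: algebra_simps\<close>)
  have mod: "h (j mod q) = h j" for j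
    using mult[of "j mod q" "j div q"] by (simp add: add.commute)
  let ?f = "\<lambda>j. (c * j) mod q"
  have inj: "inj_on ?f {..<q}"
  proof (rule linorder_inj_onI')
    fix i j assume ij: "i \<in> {..<q}" "j \<in> {..<q}" "i < j"
    show "?f i \<noteq> ?f j"
    proof
      assume "?f i = ?f j"
      then have "q dvd c * j - c * i"
        using ij mod_eq_dvd_iff_nat[of "c * i" "c * j" q] by simp
      then have "q dvd c * (j - i)"
        by (simp add: diff_mult_distrib2)
      then have "q dvd j - i"
        using cop by (simp add: coprime_commute coprime_dvd_mult_right_iff)
      then show False
        using ij by (auto dest!: dvd_imp_le)
    qed
  qed
  moreover have "?f ` {..<q} \<subseteq> {..<q}"
    using \<open>q > 0\<close> by auto
  ultimately have "?f ` {..<q} = {..<q}"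
    by (simp add: endo_inj_surj)
  then have "(\<Sum>j<q. h j) = (\<Sum>j<q. h (?f j))"
    using sum.reindex[OF inj, of h] by simp
  then show ?thesis
    by (simp add: mod)
qed

text \<open>
  After multiplication by \<open>sin (\<pi> / (2 * q))\<close> each summand is half the difference of two cosines at
  arguments \<open>\<pi> / q\<close> apart, so the sum telescopes.
\<close>

lemma sum_sin_half_turn:
  fixes y :: real
  assumes "q > 0"
  shows "sin (pi / (2 * q)) * (\<Sum>j<q. sin (y + pi * real j / real q)) = cos (y - pi / (2 * q))"
proof -
  let ?b = "pi / (2 * real q)"
  let ?F = "\<lambda>j. cos (y + (2 * real j - 1) * ?b)"
  have "2 * sin ?b * sin (y + pi * real j / real q) = ?F j - ?F (Suc j)" for j
  proof -
    have "y + pi * real j / real q = y + 2 * real j * ?b"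
      using assms by simp
    moreover have "?F j = cos (y + 2 * real j * ?b - ?b)" "?F (Suc j) = cos (y + 2 * real j * ?b + ?b)"
      by (simp_all add: algebra_simps add_divide_distrib diff_divide_distrib)
    moreover have "2 * sin ?b * sin t = cos (t - ?b) - cos (t + ?b)" for t
      by (simp add: cos_diff cos_add)
    ultimately show ?thesis
      by (simp only:)
  qed
  then have "2 * sin ?b * (\<Sum>j<q. sin (y + pi * real j / real q)) = (\<Sum>j<q. ?F j - ?F (Suc j))"
    by (simp add: sum_distrib_left)
  also have "\<dots> = ?F 0 - ?F q"
    by (rule sum_lessThan_telescope')
  also have "?F 0 = cos (y - ?b)"
    by simp
  also have "?F q = cos (y - ?b + pi)"
    using assms by (simp add: field_simps)
  also have "\<dots> = - cos (y - ?b)"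
    by simp
  finally show ?thesis by simp
qed

text \<open>
  As a function of \<open>x\<close> the sum has period \<open>\<pi> / q\<close>, so \<open>x\<close> may be moved into
  \<open>[0, \<pi> / q]\<close>. On \<open>[0, \<pi> / q]\<close> all arguments of the sine lie in \<open>[0, \<pi>]\<close>, the absolute values
  disappear, and the closed form is smallest at the end points, with value
  \<open>cot (\<pi> / (2 * q)) = q * B q\<close>.
\<close>

lemma sum_abs_sin_half_turn_ge:
  fixes x :: real
  assumes q: "q \<ge> 2" and "x \<ge> 0"
  shows "real q * B q \<le> (\<Sum>j<q. \<bar>sin (x + pi * real j / real q)\<bar>)"
proof -
  define f where "f = (\<lambda>x. \<Sum>j<q. \<bar>sin (x + pi * real j / real q)\<bar>)"
  let ?b = "pi / (2 * real q)"
  have shift: "f (x + pi / real q) = f x" for x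
  proof -
    let ?h = "\<lambda>j. \<bar>sin (x + pi * real j / real q)\<bar>"
    have "f (x + pi / real q) = (\<Sum>j<q. ?h (Suc j))"
      unfolding f_def by (intro sum.cong) (simp_all add: field_simps)
    also have "\<dots> = (\<Sum>j<Suc q. ?h j) - ?h 0"
      by (simp only: sum.lessThan_Suc_shift)
    also have "\<dots> = f x + ?h q - ?h 0"
      by (simp add: f_def)
    also have "?h q = ?h 0"
      using q by simp
    finally show ?thesis by simp
  qed
  have shifts: "f (x + real i * (pi / real q)) = f x" for i x
  proof (induction i)
    case (Suc i)
    have "x + real (Suc i) * (pi / real q) = x + real i * (pi / real q) + pi / real q"
      by (simp add: algebra_simps add_divide_distrib)
    then show ?case
      by (simp only: shift Suc)
  qed simp
  \<comment> \<open>\<open>y\<close> is the representative of \<open>x\<close> modulo \<open>\<pi> / q\<close>.\<close>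
  define i where "i = nat \<lfloor>x / (pi / real q)\<rfloor>"
  define y where "y = x - real i * (pi / real q)"
  have "pi / real q > 0"
    using q by simp
  then have i: "real i \<le> x / (pi / real q)" "x / (pi / real q) \<le> real i + 1"
    unfolding i_def using \<open>x \<ge> 0\<close> by (simp_all add: of_nat_nat)
  have y: "0 \<le> y" "y \<le> pi / real q"
    using i unfolding y_def pos_le_divide_eq[OF \<open>pi / real q > 0\<close>]
      pos_divide_le_eq[OF \<open>pi / real q > 0\<close>] distrib_right by linarith+
  have b: "0 < ?b" "?b < pi"
    using q by (simp_all add: field_simps)
  have sb: "sin ?b > 0"
    using b by (rule sin_gt_zero)
  have "\<bar>y - ?b\<bar> \<le> ?b"
    using y by (simp add: abs_le_iff)
  then have "cos ?b \<le> cos \<bar>y - ?b\<bar>"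
    using b by (intro cos_monotone_0_pi_le) auto
  then have c: "cos ?b \<le> cos (y - ?b)"
    by simp
  have "real q * B q = (1 + cos (2 * ?b)) / sin (2 * ?b)"
    using q by (simp add: B_def)
  also have "\<dots> = cos ?b / sin ?b"
    using sb unfolding cos_double_cos sin_double
    by (cases "cos ?b = 0") (simp_all add: power2_eq_square)
  also have "\<dots> \<le> cos (y - ?b) / sin ?b"
    using c sb by (simp add: divide_right_mono)
  also have "\<dots> = (\<Sum>j<q. sin (y + pi * real j / real q))"
    using sum_sin_half_turn[of q y] sb q by (simp add: field_simps)
  also have "\<dots> \<le> f y"
    unfolding f_def by (intro sum_mono) simp
  also have "\<dots> = f x"
    using shifts[of y i] by (simp add: y_def)
  finally show ?thesis
    by (simp add: f_def)
qed

text \<open>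
  The absolute sine has period \<open>\<pi>\<close>, and \<open>2 * p\<close> is invertible modulo the odd number \<open>q\<close>. Hence the
  multiples of \<open>2 * \<pi> * p / q\<close> and those of \<open>\<pi> / q\<close> give the same sum.
\<close>

lemma sum_abs_sin_rational_rotation_ge:
  fixes x :: real
  assumes q: "q \<ge> 2" "odd q" and cop: "coprime p q" and "x \<ge> 0"
  shows "real q * B q \<le> (\<Sum>j<q. \<bar>sin (x + 2 * (real j * (pi * real p / real q)))\<bar>)"
proof -
  let ?h = "\<lambda>j. \<bar>sin (x + pi * real j / real q)\<bar>"
  have "?h (j + q) = ?h j" for j
  proof -
    have "x + pi * real (j + q) / real q = x + pi * real j / real q + pi"
      using q by (simp add: field_simps)
    then show ?thesis
      by (simp only: sin_periodic_pi abs_minus_cancel)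
  qed
  moreover have "coprime (2 * p) q"
    using q cop by simp
  ultimately have "(\<Sum>j<q. ?h (2 * p * j)) = (\<Sum>j<q. ?h j)"
    using q by (intro sum_periodic_mult_coprime) auto
  moreover have "?h (2 * p * j) = \<bar>sin (x + 2 * (real j * (pi * real p / real q)))\<bar>" for j
    by (simp add: algebra_simps)
  ultimately show ?thesis
    using sum_abs_sin_half_turn_ge[OF q(1) \<open>x \<ge> 0\<close>] by simp
qed

lemma sum_abs_Im_square_rational_rotation_ge:
  fixes z :: complex
  assumes "q \<ge> 2" "odd q" "coprime p q"
  shows "real q * B q * (norm z)\<^sup>2
    \<le> (\<Sum>j<q. \<bar>Im ((cis (real j * (pi * real p / real q)) * z)\<^sup>2)\<bar>)"
proof -
  define x where "x = Arg2pi z"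
  have z: "z = of_real (norm z) * cis x"
    unfolding x_def using Arg2pi_eq[of z] by (simp add: cis_conv_exp mult.commute)
  have "Im ((cis t * z)\<^sup>2) = (norm z)\<^sup>2 * sin (2 * x + 2 * t)" for t
  proof -
    have "(cis t * z)\<^sup>2 = of_real ((norm z)\<^sup>2) * cis (2 * x + 2 * t)"
      by (subst z) (simp add: power_mult_distrib Complex.DeMoivre cis_mult add.commute)
    then show ?thesis by simp
  qed
  then have "(\<Sum>j<q. \<bar>Im ((cis (real j * (pi * real p / real q)) * z)\<^sup>2)\<bar>)
      = (norm z)\<^sup>2 * (\<Sum>j<q. \<bar>sin (2 * x + 2 * (real j * (pi * real p / real q)))\<bar>)"
    by (simp add: abs_mult sum_distrib_left)
  moreover have "x \<ge> 0"
    using Arg2pi_ge_0 by (simp add: x_def)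
  ultimately show ?thesis
    using mult_left_mono[OF sum_abs_sin_rational_rotation_ge[OF assms, of "2 * x"], of "(norm z)\<^sup>2"]
    by (simp add: mult.commute)
qed

section \<open>Rotations perturbed at order \<open>1/n\<close>\<close>

text \<open>
  Over a bounded number of steps such a sequence grows by at most a constant factor and stays
  within relative distance \<open>O(1/m)\<close> of the unperturbed rotation started at time \<open>m\<close>. The constants
  are crude; only their independence of \<open>m\<close> matters.
\<close>

lemma perturbed_rotation_growth:
  fixes z :: "nat \<Rightarrow> complex"
  assumes b: "b \<ge> 0"
    and step: "\<And>n. norm (z (Suc n) - cis \<kappa> * z n) \<le> b / (real n + 1) * norm (z n)"
  shows "norm (z (m + j)) \<le> (1 + b) ^ j * norm (z m)"
proof (induction j)
  case (Suc j)
  have "norm (z (Suc (m + j))) \<le> norm (cis \<kappa> * z (m + j)) + b / (real (m + j) + 1) * norm (z (m + j))"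
    using norm_triangle_ineq2[of "z (Suc (m + j))" "cis \<kappa> * z (m + j)"] step[of "m + j"] by linarith
  also have "b / (real (m + j) + 1) * norm (z (m + j)) \<le> b * norm (z (m + j))"
    using b by (intro mult_right_mono) (simp_all add: field_simps)
  finally have "norm (z (Suc (m + j))) \<le> (1 + b) * norm (z (m + j))"
    by (simp add: norm_mult algebra_simps)
  also have "\<dots> \<le> (1 + b) * ((1 + b) ^ j * norm (z m))"
    using Suc b by (intro mult_left_mono) auto
  finally show ?case by simp
qed simp

lemma perturbed_rotation_drift:
  fixes z :: "nat \<Rightarrow> complex"
  assumes b: "b \<ge> 0"
    and step: "\<And>n. norm (z (Suc n) - cis \<kappa> * z n) \<le> b / (real n + 1) * norm (z n)"
  shows "norm (z (m + j) - cis (real j * \<kappa>) * z m)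
    \<le> real j * b * (1 + b) ^ j / (real m + 1) * norm (z m)"
proof (induction j)
  case (Suc j)
  let ?N = "norm (z m) / (real m + 1)"
  have N: "?N \<ge> 0" by simp
  have "z (m + Suc j) - cis (real (Suc j) * \<kappa>) * z m
      = (z (Suc (m + j)) - cis \<kappa> * z (m + j)) + cis \<kappa> * (z (m + j) - cis (real j * \<kappa>) * z m)"
    by (simp add: algebra_simps cis_mult[symmetric])
  then have "norm (z (m + Suc j) - cis (real (Suc j) * \<kappa>) * z m)
      \<le> norm (z (Suc (m + j)) - cis \<kappa> * z (m + j)) + norm (z (m + j) - cis (real j * \<kappa>) * z m)"
    using norm_triangle_ineq[of "z (Suc (m + j)) - cis \<kappa> * z (m + j)"
        "cis \<kappa> * (z (m + j) - cis (real j * \<kappa>) * z m)"]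
    by (simp only: norm_mult norm_cis mult_1)
  also have "\<dots> \<le> b / (real (m + j) + 1) * norm (z (m + j))
      + real j * b * (1 + b) ^ j / (real m + 1) * norm (z m)"
    using step[of "m + j"] Suc by linarith
  also have "b / (real (m + j) + 1) * norm (z (m + j)) \<le> b / (real m + 1) * ((1 + b) ^ j * norm (z m))"
    using b perturbed_rotation_growth[OF b step, of m j]
    by (intro mult_mono divide_left_mono) auto
  also have "b / (real m + 1) * ((1 + b) ^ j * norm (z m))
      + real j * b * (1 + b) ^ j / (real m + 1) * norm (z m) = (real j + 1) * b * (1 + b) ^ j * ?N"
    by (simp add: divide_inverse algebra_simps)
  also have "\<dots> \<le> (real j + 1) * b * (1 + b) ^ Suc j * ?N"
    using b N by (intro mult_right_mono mult_left_mono power_increasing) auto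
  finally show ?case by (simp add: add.commute)
qed simp

text \<open>
  Squares inherit the \<open>O(1/m)\<close> error from \<open>v\<^sup>2 - w\<^sup>2 = (v - w) * (v + w)\<close>, whose second factor is
  bounded by the growth estimate.
\<close>

lemma perturbed_rotation_Im_square:
  fixes z :: "nat \<Rightarrow> complex"
  assumes b: "b \<ge> 0"
    and step: "\<And>n. norm (z (Suc n) - cis \<kappa> * z n) \<le> b / (real n + 1) * norm (z n)"
    and "j \<le> q"
  shows "\<bar>Im ((cis (real j * \<kappa>) * z m)\<^sup>2)\<bar>
      - real q * b * (1 + b) ^ q * ((1 + b) ^ q + 1) / (real m + 1) * (norm (z m))\<^sup>2
    \<le> \<bar>Im ((z (m + j))\<^sup>2)\<bar>"
proof -
  let ?w = "cis (real j * \<kappa>) * z m"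
  let ?P = "(1 + b) ^ q"
  have P: "(1 + b) ^ j \<le> ?P" "0 \<le> ?P"
    using b \<open>j \<le> q\<close> by (auto intro: power_increasing)
  have "norm (?w - z (m + j)) \<le> real j * b * (1 + b) ^ j / (real m + 1) * norm (z m)"
    using perturbed_rotation_drift[OF b step] by (simp add: norm_minus_commute)
  also have "\<dots> \<le> real q * b * ?P / (real m + 1) * norm (z m)"
    using b \<open>j \<le> q\<close> P by (intro mult_right_mono divide_right_mono mult_mono) auto
  finally have 1: "norm (?w - z (m + j)) \<le> real q * b * ?P / (real m + 1) * norm (z m)" .
  have "norm (?w + z (m + j)) \<le> norm (z m) + norm (z (m + j))"
    using norm_triangle_ineq[of ?w "z (m + j)"] by (simp add: norm_mult)
  also have "norm (z (m + j)) \<le> ?P * norm (z m)"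
    using perturbed_rotation_growth[OF b step, of m j] P
    by (meson mult_right_mono norm_ge_zero order_trans)
  finally have 2: "norm (?w + z (m + j)) \<le> (?P + 1) * norm (z m)"
    by (simp add: algebra_simps)
  have "\<bar>Im (?w\<^sup>2)\<bar> - \<bar>Im ((z (m + j))\<^sup>2)\<bar> \<le> \<bar>Im (?w\<^sup>2 - (z (m + j))\<^sup>2)\<bar>"
    by simp
  also have "\<dots> \<le> norm (?w\<^sup>2 - (z (m + j))\<^sup>2)"
    by (rule abs_Im_le_cmod)
  also have "\<dots> = norm (?w - z (m + j)) * norm (?w + z (m + j))"
    by (simp add: norm_mult[symmetric] power2_eq_square algebra_simps)
  also have "\<dots> \<le> (real q * b * ?P / (real m + 1) * norm (z m)) * ((?P + 1) * norm (z m))"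
    using b 1 2 by (intro mult_mono) auto
  also have "\<dots> = real q * b * ?P * (?P + 1) / (real m + 1) * (norm (z m))\<^sup>2"
    by (simp add: power2_eq_square)
  finally show ?thesis by simp
qed

text \<open>
  The damping is summed over \<open>q\<close> steps. Its coefficients \<open>b / (m + j + 1)\<close> are replaced by the
  smallest one, \<open>b / (m + q)\<close>, and the orbit by the unperturbed rotation; as the drift is itself
  \<open>O(1/m)\<close> and is multiplied by such a coefficient, the error is \<open>O(1/m\<^sup>2)\<close>, like that of the
  quadratic term.
\<close>

lemma damped_rotation_block_decay:
  fixes z :: "nat \<Rightarrow> complex"
  assumes b: "b \<ge> 0"
    and step: "\<And>n. norm (z (Suc n) - cis \<kappa> * z n) \<le> b / (real n + 1) * norm (z n)"
    and damp: "\<And>n. (norm (z (Suc n)))\<^sup>2 \<le> (norm (z n))\<^sup>2 - b / (real n + 1) * \<bar>Im ((z n)\<^sup>2)\<bar>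
                   + (b / (real n + 1))\<^sup>2 * (norm (z n))\<^sup>2"
  obtains K where "K \<ge> 0"
    and "\<And>m. (norm (z (m + q)))\<^sup>2
      \<le> (norm (z m))\<^sup>2 - b / (real m + real q) * (\<Sum>j<q. \<bar>Im ((cis (real j * \<kappa>) * z m)\<^sup>2)\<bar>)
        + K / (real m + 1)\<^sup>2 * (norm (z m))\<^sup>2"
proof
  let ?P = "(1 + b) ^ q"
  let ?L = "real q * b * ?P * (?P + 1)"
  let ?K = "b * ?L + b\<^sup>2 * ?P\<^sup>2"
  have P: "?P \<ge> 0" and L: "?L \<ge> 0" and K: "?K \<ge> 0"
    using b by auto
  show "real q * ?K \<ge> 0"
    using K by simp
  fix m
  let ?r = "(norm (z m))\<^sup>2"
  let ?s = "\<lambda>j. \<bar>Im ((cis (real j * \<kappa>) * z m)\<^sup>2)\<bar>"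
  have one: "(norm (z (m + Suc j)))\<^sup>2 \<le> (norm (z (m + j)))\<^sup>2
      - b / (real m + real q) * ?s j + ?K / (real m + 1)\<^sup>2 * ?r" if "j < q" for j
  proof -
    have "?s j - ?L / (real m + 1) * ?r \<le> \<bar>Im ((z (m + j))\<^sup>2)\<bar>"
      using that by (intro perturbed_rotation_Im_square[OF b step]) auto
    then have "b / (real m + real q) * (?s j - ?L / (real m + 1) * ?r)
        \<le> b / (real m + real q) * \<bar>Im ((z (m + j))\<^sup>2)\<bar>"
      using b by (intro mult_left_mono) auto
    also have "\<dots> \<le> b / (real (m + j) + 1) * \<bar>Im ((z (m + j))\<^sup>2)\<bar>"
      using b that by (intro mult_right_mono divide_left_mono) auto
    finally have 1: "b / (real m + real q) * ?s j - b / (real m + real q) * (?L / (real m + 1) * ?r)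
        \<le> b / (real (m + j) + 1) * \<bar>Im ((z (m + j))\<^sup>2)\<bar>"
      by (simp only: right_diff_distrib)
    have "b / (real m + real q) * (?L / (real m + 1) * ?r) \<le> b / (real m + 1) * (?L / (real m + 1) * ?r)"
      using b that L by (intro mult_right_mono divide_left_mono mult_nonneg_nonneg divide_nonneg_nonneg) auto
    then have 2: "b / (real m + real q) * (?L / (real m + 1) * ?r) \<le> b * ?L / (real m + 1)\<^sup>2 * ?r"
      by (simp add: power2_eq_square)
    have "norm (z (m + j)) \<le> ?P * norm (z m)"
      using perturbed_rotation_growth[OF b step, of m j]
        mult_right_mono[OF power_increasing[of j q "1 + b"], of "norm (z m)"] b that by simp
    then have "(norm (z (m + j)))\<^sup>2 \<le> ?P\<^sup>2 * ?r"
      by (metis norm_ge_zero power_mono power_mult_distrib)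
    moreover have "(b / (real (m + j) + 1))\<^sup>2 \<le> (b / (real m + 1))\<^sup>2"
      using b by (intro power_mono divide_left_mono) auto
    ultimately have "(b / (real (m + j) + 1))\<^sup>2 * (norm (z (m + j)))\<^sup>2 \<le> (b / (real m + 1))\<^sup>2 * (?P\<^sup>2 * ?r)"
      by (intro mult_mono) auto
    then have 3: "(b / (real (m + j) + 1))\<^sup>2 * (norm (z (m + j)))\<^sup>2 \<le> b\<^sup>2 * ?P\<^sup>2 / (real m + 1)\<^sup>2 * ?r"
      by (simp add: power_divide)
    have "?K / (real m + 1)\<^sup>2 * ?r = b * ?L / (real m + 1)\<^sup>2 * ?r + b\<^sup>2 * ?P\<^sup>2 / (real m + 1)\<^sup>2 * ?r"
      by (simp only: add_divide_distrib distrib_right)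
    then show ?thesis
      using damp[of "m + j"] 1 2 3 unfolding add_Suc_right by linarith
  qed
  have "(norm (z (m + i)))\<^sup>2 \<le> ?r - b / (real m + real q) * (\<Sum>j<i. ?s j)
      + real i * (?K / (real m + 1)\<^sup>2 * ?r)" if "i \<le> q" for i
    using that
  proof (induction i)
    case (Suc i)
    have "b / (real m + real q) * (\<Sum>j<Suc i. ?s j)
        = b / (real m + real q) * (\<Sum>j<i. ?s j) + b / (real m + real q) * ?s i"
      by (simp only: sum.lessThan_Suc distrib_left)
    moreover have "real (Suc i) * (?K / (real m + 1)\<^sup>2 * ?r)
        = real i * (?K / (real m + 1)\<^sup>2 * ?r) + ?K / (real m + 1)\<^sup>2 * ?r"
      by (simp only: of_nat_Suc distrib_right mult_1 add.commute)
    ultimately show ?case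
      using one[of i] Suc by linarith
  qed simp
  from this[of q]
  show "(norm (z (m + q)))\<^sup>2 \<le> ?r - b / (real m + real q) * (\<Sum>j<q. ?s j)
        + real q * ?K / (real m + 1)\<^sup>2 * ?r"
    by simp
qed

section \<open>Summability from decay with a lag\<close>

text \<open>
  The windowed sums \<open>G n\<close> of \<open>j * r j\<close> over \<open>q\<close> consecutive \<open>j\<close> are nonnegative, and
  the hypothesis says that passing from \<open>G n\<close> to \<open>G (n + 1)\<close> loses at least \<open>\<delta> * r n\<close>. So the partial
  sums of \<open>\<delta> * r\<close> from \<open>N\<close> on never exceed \<open>G N\<close>. For \<open>q = 1\<close> this is Raabe's test.
\<close>

lemma summable_of_lagged_decay:
  fixes r :: "nat \<Rightarrow> real"
  assumes nonneg: "\<And>n. r n \<ge> 0" and "\<delta> > 0"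
    and decay: "\<And>n. n \<ge> N \<Longrightarrow> real (n + q) * r (n + q) \<le> real n * r n - \<delta> * r n"
  shows "summable r"
proof -
  let ?g = "\<lambda>n. real n * r n"
  define G where "G = (\<lambda>n. \<Sum>j<q. ?g (n + j))"
  have G_Suc: "G n + ?g (n + q) = ?g n + G (Suc n)" for n
  proof -
    have "G n + ?g (n + q) = (\<Sum>j<Suc q. ?g (n + j))"
      by (simp add: G_def)
    also have "\<dots> = ?g n + G (Suc n)"
      by (simp only: sum.lessThan_Suc_shift G_def) simp
    finally show ?thesis .
  qed
  have "\<delta> * (\<Sum>i<k. r (N + i)) + G (N + k) \<le> G N" for k
  proof (induction k)
    case (Suc k)
    then show ?case
      using G_Suc[of "N + k"] decay[of "N + k"] by (simp add: distrib_left)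
  qed simp
  moreover have "G n \<ge> 0" for n
    unfolding G_def by (intro sum_nonneg) (simp add: nonneg)
  ultimately have "\<delta> * (\<Sum>i<k. r (N + i)) \<le> G N" for k
    by (smt (verit))
  then have "(\<Sum>i<k. r (i + N)) \<le> G N / \<delta>" for k
    using \<open>\<delta> > 0\<close> by (simp add: field_simps)
  then have "summable (\<lambda>i. r (i + N))"
    by (intro summableI_nonneg_bounded[where x = "G N / \<delta>"] nonneg)
  then show ?thesis
    by (simp only: summable_iff_shift)
qed

text \<open>
  The block estimate multiplied by \<open>m + q\<close> reads
  \<open>(m + q) * r (m + q) \<le> m * r m - q * (b * B q - 1) * r m + O(1/m) * r m\<close>.
  Half of the gain \<open>q * (b * B q - 1)\<close> absorbs the last term for large \<open>m\<close>, the other half is the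
  \<open>\<delta>\<close> of the summability criterion.
\<close>

lemma damped_rational_rotation_summable:
  fixes z :: "nat \<Rightarrow> complex"
  assumes q: "q \<ge> 2" "odd q" "coprime p q"
    and b: "b * B q > 1" "b \<ge> 0"
    and step: "\<And>n. norm (z (Suc n) - cis (pi * real p / real q) * z n) \<le> b / (real n + 1) * norm (z n)"
    and damp: "\<And>n. (norm (z (Suc n)))\<^sup>2 \<le> (norm (z n))\<^sup>2 - b / (real n + 1) * \<bar>Im ((z n)\<^sup>2)\<bar>
                   + (b / (real n + 1))\<^sup>2 * (norm (z n))\<^sup>2"
  shows "summable (\<lambda>n. (norm (z n))\<^sup>2)"
proof -
  let ?r = "\<lambda>n. (norm (z n))\<^sup>2"
  obtain K where "K \<ge> 0" and K: "\<And>m. ?r (m + q) \<le> ?r m - b / (real m + real q)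
      * (\<Sum>j<q. \<bar>Im ((cis (real j * (pi * real p / real q)) * z m)\<^sup>2)\<bar>) + K / (real m + 1)\<^sup>2 * ?r m"
    using damped_rotation_block_decay[OF b(2) step damp] by metis
  define \<delta> where "\<delta> = real q * (b * B q - 1) / 2"
  have \<delta>: "\<delta> > 0"
    using q b by (simp add: \<delta>_def)
  obtain N :: nat where N: "real N > K * real q / \<delta>"
    using reals_Archimedean2 by blast
  have "real (m + q) * ?r (m + q) \<le> real m * ?r m - \<delta> * ?r m" if "m \<ge> N" for m
  proof -
    have "b / (real m + real q) * (real q * B q * ?r m) \<le> b / (real m + real q)
      * (\<Sum>j<q. \<bar>Im ((cis (real j * (pi * real p / real q)) * z m)\<^sup>2)\<bar>)"
      using b by (intro mult_left_mono sum_abs_Im_square_rational_rotation_ge q) auto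
    then have "?r (m + q) \<le> ?r m - b / (real m + real q) * (real q * B q * ?r m)
        + K / (real m + 1)\<^sup>2 * ?r m"
      using K[of m] by linarith
    then have "(real m + real q) * ?r (m + q) \<le> (real m + real q) * (?r m
        - b / (real m + real q) * (real q * B q * ?r m) + K / (real m + 1)\<^sup>2 * ?r m)"
      by (intro mult_left_mono) auto
    also have "\<dots> = (real m + real q) * ?r m - b * (real q * B q) * ?r m
        + (real m + real q) * (K / (real m + 1)\<^sup>2) * ?r m"
    proof -
      have "(real m + real q) * (b / (real m + real q) * t) = b * t" for t
        using q by simp
      then show ?thesis
        by (simp only: distrib_left right_diff_distrib mult.assoc)
    qed
    also have "(real m + real q) * (K / (real m + 1)\<^sup>2) \<le> \<delta>"
    proof -
      have "real m + real q \<le> real q * (real m + 1)"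
      proof -
        have "1 * real m \<le> real q * real m"
          using q by (intro mult_right_mono) auto
        then show ?thesis by (simp add: algebra_simps)
      qed
      then have "(real m + real q) * (K / (real m + 1)\<^sup>2) \<le> real q * (real m + 1) * (K / (real m + 1)\<^sup>2)"
        using \<open>K \<ge> 0\<close> by (intro mult_right_mono) auto
      also have "\<dots> = K * real q / (real m + 1)"
        by (simp add: power2_eq_square)
      also have "\<dots> \<le> \<delta>"
      proof -
        have "K * real q / \<delta> \<le> real m + 1"
          using N that by linarith
        then show ?thesis
          using \<delta> by (simp add: field_simps)
      qed
      finally show ?thesis .
    qed
    finally show ?thesis
      by (simp add: \<delta>_def algebra_simps add_divide_distrib diff_divide_distrib mult_right_mono)
  qed
  then show ?thesis
    using \<delta> by (intro summable_of_lagged_decay[of ?r \<delta> N q]) auto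
qed

section \<open>The potential\<close>

text \<open>
  The potential value at site \<open>n\<close>, given \<open>x = u n\<close> and \<open>y = u (n - 1)\<close>. The quantity
  \<open>x * (E * x - 2 * y)\<close> has the sign of \<open>Im (z\<^sup>2)\<close> for \<open>z = e\<^sup>i\<^sup>\<kappa> * x - y\<close>. When it vanishes, the
  potential still takes the value \<open>a / n\<close>, so that \<open>|n * V n| = a\<close> without exception.
\<close>

definition damping_value :: "real \<Rightarrow> real \<Rightarrow> nat \<Rightarrow> real \<Rightarrow> real \<Rightarrow> real" where
  "damping_value a E n x y = (if x * (E * x - 2 * y) \<ge> 0 then a else - a) / real n"

fun damped_solution :: "real \<Rightarrow> real \<Rightarrow> real \<Rightarrow> nat \<Rightarrow> real" where
  "damped_solution a E \<theta> 0 = cos \<theta>"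
| "damped_solution a E \<theta> (Suc 0) = sin \<theta>"
| "damped_solution a E \<theta> (Suc (Suc n)) =
     (let x = damped_solution a E \<theta> (Suc n); y = damped_solution a E \<theta> n
      in E * x - y - damping_value a E (Suc n) x y * x)"

definition damping_potential :: "real \<Rightarrow> real \<Rightarrow> real \<Rightarrow> nat \<Rightarrow> real" where
  "damping_potential a E \<theta> n =
     damping_value a E n (damped_solution a E \<theta> n) (damped_solution a E \<theta> (n - 1))"

lemma damped_solution_schroedinger:
  assumes "n \<ge> 1"
  shows "schroedinger (damping_potential a E \<theta>) (damped_solution a E \<theta>) n
    = E * damped_solution a E \<theta> n"
proof -
  obtain k where "n = Suc k"
    using assms by (cases n) auto
  then show ?thesis
    by (simp add: schroedinger_def damping_potential_def Let_def)
qed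

lemma abs_mult_damping_potential:
  assumes "a \<ge> 0" "n \<ge> 1"
  shows "\<bar>real n * damping_potential a E \<theta> n\<bar> = a"
  using assms by (simp add: damping_potential_def damping_value_def)

text \<open>
  The sequence \<open>z\<close> is a damped rotation with strength \<open>b = a / sin \<kappa>\<close>: its deviation from the
  rotation is \<open>|V * u| \<le> b / (n + 1) * |z|\<close>, and the sign of \<open>V\<close> makes the cross term of
  \<open>|z - V * u|\<^sup>2\<close> equal to \<open>- b / (n + 1) * |Im (z\<^sup>2)|\<close>. As \<open>sin \<kappa> \<le> 1\<close>, the threshold
  \<open>a * B q > 1\<close> implies \<open>b * B q > 1\<close>.
\<close>

lemma damped_solution_summable:
  assumes q: "q \<ge> 2" "odd q" "coprime p q" and p: "0 < p" "p < q"
    and E: "E = 2 * cos (pi * real p / real q)"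
    and a: "a \<ge> 0" "a * B q > 1"
  shows "summable (\<lambda>n. (damped_solution a E \<theta> (Suc n))\<^sup>2)"
proof -
  define u where "u = damped_solution a E \<theta>"
  define V where "V = damping_potential a E \<theta>"
  define \<kappa> where "\<kappa> = pi * real p / real q"
  define s where "s = sin \<kappa>"
  define z where "z = (\<lambda>n. cis \<kappa> * of_real (u (Suc n)) - of_real (u n))"
  define b where "b = a / s"
  have "0 < \<kappa>" "\<kappa> < pi"
    using p q by (simp_all add: \<kappa>_def field_simps)
  then have s: "0 < s" "s \<le> 1"
    by (auto simp: s_def intro: sin_gt_zero)
  have "B q > 0"
    using a by (smt (verit) mult_nonneg_nonpos)
  have b: "b \<ge> 0" "b * B q > 1"
  proof -
    show "b \<ge> 0"
      using a s by (simp add: b_def)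
    have "a \<le> b"
      using a s mult_left_mono[of s 1 a] by (simp add: b_def pos_le_divide_eq)
    then have "a * B q \<le> b * B q"
      using \<open>B q > 0\<close> by (simp add: mult_right_mono)
    then show "b * B q > 1"
      using a by linarith
  qed
  have Ek: "E = 2 * cos \<kappa>"
    by (simp add: E \<kappa>_def)
  have rec: "u (Suc (Suc n)) = E * u (Suc n) - u n - V (Suc n) * u (Suc n)" for n
    by (simp add: u_def V_def damping_potential_def Let_def)
  have Re: "Re (z n) = cos \<kappa> * u (Suc n) - u n" and Im: "Im (z n) = s * u (Suc n)" for n
    by (simp_all add: z_def s_def)
  have u: "\<bar>u (Suc n)\<bar> \<le> norm (z n) / s" for n
    using abs_Im_le_cmod[of "z n"] s by (simp add: Im abs_mult field_simps)
  have sc: "(cos \<kappa>)\<^sup>2 + s\<^sup>2 = 1"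
    by (simp add: s_def)
  have z_Suc: "z (Suc n) = cis \<kappa> * (z n - of_real (V (Suc n) * u (Suc n)))" for n
  proof (rule complex_eqI)
    have "cos \<kappa> * (cos \<kappa> * u (Suc n) - u n - V (Suc n) * u (Suc n)) - s * (s * u (Suc n))
      = cos \<kappa> * u (Suc (Suc n)) - ((cos \<kappa>)\<^sup>2 + s\<^sup>2) * u (Suc n)"
      unfolding rec Ek by (simp add: algebra_simps power2_eq_square)
    then show "Re (z (Suc n)) = Re (cis \<kappa> * (z n - of_real (V (Suc n) * u (Suc n))))"
      using sc by (simp add: Re Im s_def[symmetric])
    show "Im (z (Suc n)) = Im (cis \<kappa> * (z n - of_real (V (Suc n) * u (Suc n))))"
      unfolding Im rec Ek by (simp add: Re Im s_def[symmetric] algebra_simps)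
  qed
  have absV: "\<bar>V (Suc n)\<bar> = a / (real n + 1)" for n
    using abs_mult_damping_potential[OF a(1), of "Suc n" E \<theta>]
    by (simp add: V_def abs_mult eq_divide_eq mult.commute add.commute)
  have Vu: "\<bar>V (Suc n) * u (Suc n)\<bar> \<le> b / (real n + 1) * norm (z n)" for n
  proof -
    have "\<bar>V (Suc n) * u (Suc n)\<bar> \<le> a / (real n + 1) * (norm (z n) / s)"
      unfolding abs_mult absV using a u[of n] by (intro mult_left_mono) auto
    then show ?thesis
      by (simp add: b_def mult.commute)
  qed
  have step: "norm (z (Suc n) - cis \<kappa> * z n) \<le> b / (real n + 1) * norm (z n)" for n
  proof -
    have "z (Suc n) - cis \<kappa> * z n = - (cis \<kappa> * of_real (V (Suc n) * u (Suc n)))"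
      by (simp add: z_Suc algebra_simps)
    then have "norm (z (Suc n) - cis \<kappa> * z n) = \<bar>V (Suc n) * u (Suc n)\<bar>"
      by (simp only: norm_minus_cancel norm_mult norm_cis norm_of_real mult_1)
    then show ?thesis
      using Vu by simp
  qed
  have damp: "(norm (z (Suc n)))\<^sup>2 \<le> (norm (z n))\<^sup>2 - b / (real n + 1) * \<bar>Im ((z n)\<^sup>2)\<bar>
      + (b / (real n + 1))\<^sup>2 * (norm (z n))\<^sup>2" for n
  proof -
    let ?x = "u (Suc n)" and ?y = "u n" and ?V = "V (Suc n)"
    have "?V * (?x * (E * ?x - 2 * ?y)) = a / (real n + 1) * \<bar>?x * (E * ?x - 2 * ?y)\<bar>"
      by (simp add: V_def damping_potential_def damping_value_def u_def add.commute)
    moreover have "Im ((z n)\<^sup>2) = s * (?x * (E * ?x - 2 * ?y))"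
      by (simp add: power2_eq_square Re Im Ek algebra_simps)
    then have "\<bar>Im ((z n)\<^sup>2)\<bar> = s * \<bar>?x * (E * ?x - 2 * ?y)\<bar>"
      using s by (simp add: abs_mult)
    moreover have "2 * Re (z n) * (?V * ?x) = ?V * (?x * (E * ?x - 2 * ?y))"
      by (simp add: Re Ek algebra_simps)
    ultimately have cross: "2 * Re (z n) * (?V * ?x) = b / (real n + 1) * \<bar>Im ((z n)\<^sup>2)\<bar>"
      using s by (simp only: b_def) simp
    have "(norm (z (Suc n)))\<^sup>2 = (norm (z n - of_real (?V * ?x)))\<^sup>2"
      by (simp add: z_Suc norm_mult)
    also have "\<dots> = (norm (z n))\<^sup>2 - 2 * Re (z n) * (?V * ?x) + (?V * ?x)\<^sup>2"
      unfolding cmod_power2 by (simp add: power2_eq_square algebra_simps)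
    also have "(?V * ?x)\<^sup>2 \<le> (b / (real n + 1) * norm (z n))\<^sup>2"
      using Vu[of n] by (intro power2_le_iff_abs_le[THEN iffD2]) (use b in auto)
    finally show ?thesis
      by (simp only: cross power_mult_distrib)
  qed
  have "summable (\<lambda>n. (norm (z n))\<^sup>2)"
    using damped_rational_rotation_summable[OF q b(2,1), of z] step damp
    by (simp add: \<kappa>_def)
  then have "summable (\<lambda>n. (norm (z n))\<^sup>2 / s\<^sup>2)"
    by (rule summable_divide)
  moreover have "norm ((u (Suc n))\<^sup>2) \<le> (norm (z n))\<^sup>2 / s\<^sup>2" for n
    using power_mono[OF u[of n], of 2] by (simp add: power_divide)
  ultimately show ?thesis
    unfolding u_def[symmetric] by (rule summable_comparison_test')
qed

theorem theorem2p7: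
  fixes q :: nat and a \<theta> E :: real
  assumes "q \<ge> 3" and "odd q"
    and "a > 1 / B q"
    and "\<theta> \<in> {0..pi}"
    and "E \<in> S q"
  shows "\<exists>V :: nat \<Rightarrow> real.
           limsup (\<lambda>n. ereal \<bar>real n * V n\<bar>) = ereal a \<and>
           is_eigenvalue V \<theta> E"
proof -
  obtain p where E: "E \<in> {-2<..<2}" and p: "p \<in> {1..q - 1}" "gcd p q = 1"
    and quasi: "quasimomentum E = real p / real q"
    using assms by (auto simp: S_def)
  have "E = 2 * cos (pi * quasimomentum E)"
    using theI'[OF quasimomentum_unique[OF E]] by (simp add: quasimomentum_def)
  then have Ecos: "E = 2 * cos (pi * real p / real q)"
    by (simp add: quasi)
  have "0 < pi / real q" "pi / real q < pi"
    using assms(1) by (simp_all add: field_simps)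
  then have "sin (pi / real q) > 0" "cos (pi / real q) > -1"
    using sin_gt_zero cos_monotone_0_pi[of "pi / real q" pi] by auto
  then have "B q > 0"
    using assms(1) by (simp add: B_def)
  then have "1 / B q > 0" "a * B q > 1"
    using assms(3) by (simp_all add: field_simps)
  then have a: "a > 0" "a * B q > 1"
    using assms(3) by linarith+
  define V where "V = damping_potential a E \<theta>"
  define u where "u = damped_solution a E \<theta>"
  have "eventually (\<lambda>n. ereal \<bar>real n * V n\<bar> = ereal a) sequentially"
    using a by (intro eventually_sequentiallyI[of 1]) (simp add: V_def abs_mult_damping_potential)
  then have "limsup (\<lambda>n. ereal \<bar>real n * V n\<bar>) = ereal a"
    by (intro lim_imp_Limsup tendsto_eventually) auto
  moreover have "is_eigenvalue V \<theta> E"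
    unfolding is_eigenvalue_def
  proof (intro exI conjI)
    have "u 0 \<noteq> 0 \<or> u 1 \<noteq> 0"
      using sin_zero_abs_cos_one[of \<theta>] by (auto simp: u_def)
    then show "u (if u 0 \<noteq> 0 then 0 else 1) \<noteq> 0"
      by auto
    show "\<forall>n\<ge>1. schroedinger V u n = E * u n"
      by (simp add: u_def V_def damped_solution_schroedinger)
    show "boundary_condition \<theta> u"
      by (simp add: boundary_condition_def u_def)
    show "summable (\<lambda>n. (u (Suc n))\<^sup>2)"
      unfolding u_def
      using assms(1,2) p a Ecos by (intro damped_solution_summable[of q p]) (auto simp: coprime_iff_gcd_eq_1)
  qed
  ultimately show ?thesis
    by blast
qed

end
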